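(* Let $S:\mathbb{R}^n\rightrightarrows\mathbb{R}^m$ be a set-valued mapping, let $\bar{x}\in \operatorname{dom} S$ and $\bar{u}\in S(\bar{x})$. Assume that $\operatorname{gph} S$ is locally closed at $(\bar{x},\bar{u})$ and that $\operatorname{dom} S$ is closed and convex around $\bar{x}$. Assume further: (i) for every $x\in T_{\operatorname{dom} S}(\bar{x})$ and every sequence $t_k\downarrow 0$ there exists some $u\in\mathbb{R}^m$ such that $$\liminf_{k\to\infty}\frac{d\big((\bar{x}+t_kx,\bar{u}+t_ku),\operatorname{gph} S\big)}{t_k}=0;$$ (ii) the equality $D^*S\big((\bar{x},\bar{u});(x,u)\big)(0)=\{0\}$ holds for all $x\in T_{\operatorname{dom} S}(\bar{x})$ and $(x,u)\in T_{\operatorname{gph} S}(\bar{x},\bar{u})$ with $(x,u)\neq(0,0)$. Then $D^*_{\operatorname{dom} S}S(\bar{x}\mid\bar{u})(0)=\{0\}$, and $S$ has the Lipschitz-like property relative to $\operatorname{dom} S$ at $\bar{x}$ for $\bar{u}$.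
   Context: For $S:\mathbb{R}^n\rightrightarrows\mathbb{R}^m$: $\operatorname{gph} S=\{(x,u)\mid u\in S(x)\}$, $\operatorname{dom} S=\{x\mid S(x)\neq\emptyset\}$. A set $C$ is locally closed at $x\in C$ if $C\cap U$ is closed for some closed neighborhood $U$ of $x$; "$\operatorname{dom} S$ is closed and convex around $\bar x$" means that the intersection of $\operatorname{dom} S$ with some closed convex neighborhood of $\bar x$ is closed and convex. $d(z,C)=\inf_{y\in C}\|y-z\|$. For $C\subset\mathbb{R}^n$ and $x\in C$: the tangent (contingent) cone $T_C(x)$ is the set of $w$ for which there are $t_k\searrow0$ and $w_k\to w$ with $x+t_kw_k\in C$ for all $k$; the regular normal cone $\widehat N_C(x)$ is the polar of $T_C(x)$, i.e. $\{v\mid\langle v,w\rangle\le0\ \forall w\in T_C(x)\}$; the (limiting) normal cone $N_C(x)$ is the set of $v$ for which there are $x_k\to x$ with $x_k\in C$ and $v_k\in\widehat N_C(x_k)$ with $v_k\to v$. For $x\notin C$ all these are empty. Directional limiting normal cone to $\Omega$ at $\bar z\in\Omega$ in direction $d$: $N_\Omega(\bar z;d):=\limsup_{t\downarrow0,\,d'\to d}\widehat N_\Omega(\bar z+td')$ (outer limit of sets). Directional limiting coderivative of $S$ in direction $(x,u)$ at $(\bar x,\bar u)\in\operatorname{gph} S$: $D^*S((\bar x,\bar u);(x,u))(v^* ):=\{u^*\in\mathbb{R}^n\mid(u^*,-v^* )\in N_{\operatorname{gph} S}((\bar x,\bar u);(x,u))\}$. For $X\subseteq\mathbb{R}^n$,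 $S|_X(x)=S(x)$ if $x\in X$ and $\emptyset$ otherwise. Projection of a set: $\operatorname{proj}_CZ=\{y\in C\mid\exists z\in Z:\|y-z\|=d(z,C)\}$. Projectional coderivative of $S$ at $\bar x\in X$ for $\bar u\in S(\bar x)$ with respect to $X$: $t^*\in D^*_XS(\bar x\mid\bar u)(u^* )$ iff $$(t^*,-u^* )\in\limsup_{(x,u)\to(\bar x,\bar u),\ (x,u)\in\operatorname{gph} S|_X}\operatorname{proj}_{T_X(x)\times\mathbb{R}^m}N_{\operatorname{gph} S|_X}(x,u).$$ $S$ is Lipschitz-like relative to $X$ at $\bar x$ for $\bar u$ (with $\bar x\in X$, $\bar u\in S(\bar x)$) if $\operatorname{gph} S$ is locally closed at $(\bar x,\bar u)$ and there are neighborhoods $V$ of $\bar x$, $W$ of $\bar u$ and $\kappa\ge0$ with $S(x')\cap W\subset S(x)+\kappa\|x'-x\|\mathbb{B}$ for all $x,x'\in X\cap V$, where $\mathbb{B}$ is the closed unit ball. *)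

theory Defs
  imports "HOL-Analysis.Analysis"
begin

text \<open>A set-valued mapping from \<open>R^n\<close> to \<open>R^m\<close> is a function
  \<^typ>\<open>'a \<Rightarrow> 'b set\<close>.\<close>

definition gph :: "('a \<Rightarrow> 'b set) \<Rightarrow> ('a \<times> 'b) set" where
  "gph S = {(x, u). u \<in> S x}"

definition sdom :: "('a \<Rightarrow> 'b set) \<Rightarrow> 'a set" where
  "sdom S = {x. S x \<noteq> {}}"

definition restrict_to :: "('a \<Rightarrow> 'b set) \<Rightarrow> 'a set \<Rightarrow> 'a \<Rightarrow> 'b set" where
  "restrict_to S X = (\<lambda>x. if x \<in> X then S x else {})"

definition locally_closed_at :: "'a::topological_space set \<Rightarrow> 'a \<Rightarrow> bool" where
  "locally_closed_at C x \<longleftrightarrow>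
     x \<in> C \<and> (\<exists>U. closed U \<and> x \<in> interior U \<and> closed (C \<inter> U))"

definition closed_convex_around :: "'a::real_normed_vector set \<Rightarrow> 'a \<Rightarrow> bool" where
  "closed_convex_around C x \<longleftrightarrow>
     (\<exists>U. closed U \<and> convex U \<and> x \<in> interior U \<and> closed (C \<inter> U) \<and> convex (C \<inter> U))"

definition tangent_cone :: "'a::real_normed_vector set \<Rightarrow> 'a \<Rightarrow> 'a set" where
  "tangent_cone C x = {w. x \<in> C \<and>
     (\<exists>t w'. (\<forall>k::nat. 0 < t k) \<and> t \<longlonglongrightarrow> 0 \<and> w' \<longlonglongrightarrow> w \<and>
       (\<forall>k. x + t k *\<^sub>R w' k \<in> C))}"

definition polar_cone :: "'a::real_inner set \<Rightarrow> 'a set" where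
  "polar_cone K = {v. \<forall>w\<in>K. v \<bullet> w \<le> 0}"

definition regular_normal_cone :: "'a::real_inner set \<Rightarrow> 'a \<Rightarrow> 'a set" where
  "regular_normal_cone C x = (if x \<in> C then polar_cone (tangent_cone C x) else {})"

definition normal_cone :: "'a::real_inner set \<Rightarrow> 'a \<Rightarrow> 'a set" where
  "normal_cone C x = {v. x \<in> C \<and>
     (\<exists>x' v'. x' \<longlonglongrightarrow> x \<and> v' \<longlonglongrightarrow> v \<and>
       (\<forall>k::nat. x' k \<in> C \<and> v' k \<in> regular_normal_cone C (x' k)))}"

text \<open>Painleve-Kuratowski outer limit of the sets \<open>G y\<close> as \<open>y\<close> tends along the filter \<open>F\<close>.\<close>

definition outer_limit :: "('b \<Rightarrow> 'a::topological_space set) \<Rightarrow> 'b filter \<Rightarrow> 'a set" where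
  "outer_limit G F = {v.
     \<exists>y v'. filterlim y F sequentially \<and> (\<forall>k::nat. v' k \<in> G (y k)) \<and> v' \<longlonglongrightarrow> v}"

definition dir_normal_cone :: "'a::real_inner set \<Rightarrow> 'a \<Rightarrow> 'a \<Rightarrow> 'a set" where
  "dir_normal_cone \<Omega> z d =
     outer_limit (\<lambda>(t, d'). regular_normal_cone \<Omega> (z + t *\<^sub>R d')) (at_right 0 \<times>\<^sub>F nhds d)"

text \<open>In \<open>dir_coderivative S z d v\<close>, \<open>z\<close> is the reference point in the graph and \<open>d\<close> the direction.\<close>

definition dir_coderivative ::
  "('a::real_inner \<Rightarrow> 'b::real_inner set) \<Rightarrow> 'a \<times> 'b \<Rightarrow> 'a \<times> 'b \<Rightarrow> 'b \<Rightarrow> 'a set" where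
  "dir_coderivative S z d v = {u. (u, - v) \<in> dir_normal_cone (gph S) z d}"

text \<open>\<open>proj_set C Z\<close> is the projection of the set \<open>Z\<close> onto \<open>C\<close>. The library convention
  \<open>infdist z {} = 0\<close> is harmless because \<open>y\<close> ranges over \<open>C\<close>.\<close>

definition proj_set :: "'a::real_normed_vector set \<Rightarrow> 'a set \<Rightarrow> 'a set" where
  "proj_set C Z = {y \<in> C. \<exists>z\<in>Z. norm (y - z) = infdist z C}"

text \<open>The filter below is convergence to \<open>(x, u)\<close> within the graph of the restriction; unlike
  \<open>at (x, u) within _\<close> it does not exclude the limit point itself.\<close>

definition proj_coderivative ::
  "('a::real_inner \<Rightarrow> 'b::real_inner set) \<Rightarrow> 'a set \<Rightarrow> 'a \<Rightarrow> 'b \<Rightarrow> 'b \<Rightarrow> 'a set" where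
  "proj_coderivative S X x u v = {t.
     (t, - v) \<in> outer_limit
       (\<lambda>(x', u'). proj_set (tangent_cone X x' \<times> UNIV)
                            (normal_cone (gph (restrict_to S X)) (x', u')))
       (inf (nhds (x, u)) (principal (gph (restrict_to S X))))}"

definition lipschitz_like_rel ::
  "('a::real_normed_vector \<Rightarrow> 'b::real_normed_vector set) \<Rightarrow> 'a set \<Rightarrow> 'a \<Rightarrow> 'b \<Rightarrow> bool" where
  "lipschitz_like_rel S X x0 u0 \<longleftrightarrow>
     x0 \<in> X \<and> u0 \<in> S x0 \<and> locally_closed_at (gph S) (x0, u0) \<and>
     (\<exists>V W. \<exists>\<kappa>::real. x0 \<in> interior V \<and> u0 \<in> interior W \<and> 0 \<le> \<kappa> \<and>
       (\<forall>x\<in>X \<inter> V. \<forall>x'\<in>X \<inter> V.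
          S x' \<inter> W \<subseteq> {u + (\<kappa> * norm (x' - x)) *\<^sub>R b | u b. u \<in> S x \<and> b \<in> cball 0 1}))"

end

theory Submission
  imports Defs
begin

text \<open>By compactness, (ii) gives \<open>l * norm a \<le> norm v\<close> for all regular normals \<open>(a, v)\<close> to the graph
  at points near but different from \<open>z0 = (x0, u0)\<close>. At \<open>z0\<close> itself there are two cases. If the graph
  contains arbitrarily close points \<open>(x', u')\<close> with \<open>norm (x' - x0)\<close> small relative to their distance
  from \<open>z0\<close>, minimising the distance to a prescribed base point over the graph near such a point shows
  that \<open>x0\<close> is interior to the domain; then (i) supplies tangents to the graph over all coordinate
  directions, and pairing with them bounds \<open>a\<close>. Otherwise every tangent \<open>(t, u)\<close> to the graph satisfies
  \<open>norm u \<le> M * norm t\<close>, and pairing \<open>(a, v)\<close> with a tangent over the projection \<open>t\<close> of \<open>a\<close>, again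
  supplied by (i), bounds \<open>norm t\<close>. The resulting estimate on projected normals gives the
  coderivative criterion, and the same minimisation turns it into the Lipschitz-like property.\<close>

section \<open>Tangent cones\<close>

lemma tendsto_0_if_le_inverse:
  fixes x :: "nat \<Rightarrow> 'a::real_normed_vector"
  assumes "\<And>k. norm (x k) \<le> inverse (real (Suc k))"
  shows "x \<longlonglongrightarrow> 0"
  by (rule Lim_null_comparison[OF always_eventually LIMSEQ_inverse_real_of_nat]) (rule allI, rule assms)

text \<open>One tolerance \<open>e\<close> controls step length and direction together, and
  \<open>e = inverse (Suc k)\<close> recovers the sequences. This form proves tangency without
  building sequences.\<close>

lemma tangent_cone_iff:
  "w \<in> tangent_cone C x \<longleftrightarrow>
     x \<in> C \<and> (\<forall>e>0. \<exists>t w'. 0 < t \<and> t < e \<and> dist w' w < e \<and> x + t *\<^sub>R w' \<in> C)"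
proof
  assume "w \<in> tangent_cone C x"
  then obtain t w' where x: "x \<in> C" and t: "\<And>k::nat. 0 < t k" "t \<longlonglongrightarrow> 0" and w: "w' \<longlonglongrightarrow> w"
    and C: "\<And>k. x + t k *\<^sub>R w' k \<in> C"
    unfolding tangent_cone_def by blast
  have "\<exists>t w'. 0 < t \<and> t < e \<and> dist w' w < e \<and> x + t *\<^sub>R w' \<in> C" if "e > 0" for e
  proof -
    have "\<forall>\<^sub>F k in sequentially. t k < e" using t(2) that by (rule order_tendstoD)
    moreover have "\<forall>\<^sub>F k in sequentially. dist (w' k) w < e" using w that by (rule tendstoD)
    ultimately have "\<forall>\<^sub>F k in sequentially. t k < e \<and> dist (w' k) w < e" by eventually_elim auto
    then obtain k where "t k < e" "dist (w' k) w < e" by (auto simp: eventually_sequentially)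
    then show ?thesis using t(1) C by blast
  qed
  with x show "x \<in> C \<and> (\<forall>e>0. \<exists>t w'. 0 < t \<and> t < e \<and> dist w' w < e \<and> x + t *\<^sub>R w' \<in> C)" by blast
next
  assume R: "x \<in> C \<and> (\<forall>e>0. \<exists>t w'. 0 < t \<and> t < e \<and> dist w' w < e \<and> x + t *\<^sub>R w' \<in> C)"
  have "\<forall>k::nat. \<exists>t w'. 0 < t \<and> t < inverse (real (Suc k)) \<and> dist w' w < inverse (real (Suc k))
          \<and> x + t *\<^sub>R w' \<in> C"
    using R by simp
  then obtain t w' where tw: "\<And>k::nat. 0 < t k" "\<And>k. t k < inverse (real (Suc k))"
      "\<And>k. dist (w' k) w < inverse (real (Suc k))" "\<And>k. x + t k *\<^sub>R w' k \<in> C"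
    by metis
  have "t \<longlonglongrightarrow> 0"
    by (rule tendsto_0_if_le_inverse) (use tw(1,2) in \<open>simp add: less_imp_le del: of_nat_Suc\<close>)
  moreover have "(\<lambda>k. dist (w' k) w) \<longlonglongrightarrow> 0"
    by (rule tendsto_0_if_le_inverse) (use tw(3) in \<open>simp add: less_imp_le del: of_nat_Suc\<close>)
  then have "w' \<longlonglongrightarrow> w" by (rule tendsto_dist_iff[THEN iffD2])
  ultimately show "w \<in> tangent_cone C x"
    using R tw unfolding tangent_cone_def by blast
qed

lemma tangent_coneI_seq:
  fixes t :: "nat \<Rightarrow> real"
  assumes "x \<in> C" "\<And>k. 0 < t k" "t \<longlonglongrightarrow> 0" "w' \<longlonglongrightarrow> w" "\<And>k. x + t k *\<^sub>R w' k \<in> C"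
  shows "w \<in> tangent_cone C x"
  using assms unfolding tangent_cone_def by blast

lemma tangent_cone_scaleR:
  assumes "w \<in> tangent_cone C x" "0 < s"
  shows "s *\<^sub>R w \<in> tangent_cone C x"
proof -
  obtain t w' where x: "x \<in> C" and t: "\<And>k::nat. 0 < t k" "t \<longlonglongrightarrow> 0" and w: "w' \<longlonglongrightarrow> w"
    and C: "\<And>k. x + t k *\<^sub>R w' k \<in> C"
    using assms(1) unfolding tangent_cone_def by blast
  show ?thesis
  proof (rule tangent_coneI_seq)
    show "(\<lambda>k. t k / s) \<longlonglongrightarrow> 0" using tendsto_divide[OF t(2) tendsto_const[of s]] assms(2) by simp
    show "(\<lambda>k. s *\<^sub>R w' k) \<longlonglongrightarrow> s *\<^sub>R w" by (intro tendsto_intros w)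
  qed (use x t C assms(2) in auto)
qed

lemma zero_in_tangent_cone: "x \<in> C \<Longrightarrow> 0 \<in> tangent_cone C x"
  by (rule tangent_coneI_seq[where t = "\<lambda>k. inverse (real (Suc k))" and w' = "\<lambda>_. 0"])
     (auto simp: LIMSEQ_inverse_real_of_nat simp del: of_nat_Suc)

lemma tangent_cone_interior:
  assumes "x \<in> interior C"
  shows "tangent_cone C x = UNIV"
proof -
  obtain r where r: "r > 0" "cball x r \<subseteq> C" using assms mem_interior_cball by blast
  have "w \<in> tangent_cone C x" for w
    unfolding tangent_cone_iff
  proof (intro conjI allI impI)
    show "x \<in> C" using assms interior_subset by blast
    fix e :: real assume e: "e > 0"
    define t where "t = min (e / 2) (r / (norm w + 1))"
    have n: "norm w + 1 > 0" by (simp add: add_nonneg_pos)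
    then have t: "0 < t" "t < e" using r e by (auto simp: t_def)
    have "t * norm w \<le> r / (norm w + 1) * (norm w + 1)"
      using t r n by (intro mult_mono) (auto simp: t_def)
    then have "t * norm w \<le> r" using n by simp
    then have "x + t *\<^sub>R w \<in> C" using r(2) t by (auto simp: dist_norm subset_iff)
    then show "\<exists>t w'. 0 < t \<and> t < e \<and> dist w' w < e \<and> x + t *\<^sub>R w' \<in> C" using t e by force
  qed
  then show ?thesis by blast
qed

lemma diff_in_tangent_cone:
  assumes "closed_segment y x \<subseteq> C"
  shows "x - y \<in> tangent_cone C y"
proof (rule tangent_coneI_seq)
  show "(\<lambda>k. inverse (real (Suc k))) \<longlonglongrightarrow> 0" by (rule LIMSEQ_inverse_real_of_nat)
  fix k :: nat
  have "y + inverse (real (Suc k)) *\<^sub>R (x - y) = (1 - inverse (real (Suc k))) *\<^sub>R y + inverse (real (Suc k)) *\<^sub>R x"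
    by (simp add: algebra_simps)
  also have "\<dots> \<in> closed_segment y x"
    unfolding closed_segment_def
    by (intro CollectI exI[of _ "inverse (real (Suc k))"]) (simp add: inverse_le_1_iff)
  finally show "y + inverse (real (Suc k)) *\<^sub>R (x - y) \<in> C" using assms by blast
qed (use assms in \<open>auto\<close>)

section \<open>Normal cones, Fermat's rule and penalised minimisation\<close>

lemma regular_normal_cone_scaleR:
  "v \<in> regular_normal_cone C x \<Longrightarrow> 0 \<le> s \<Longrightarrow> s *\<^sub>R v \<in> regular_normal_cone C x"
  unfolding regular_normal_cone_def polar_cone_def
  by (auto simp: mult_nonneg_nonpos split: if_splits)

lemma closed_regular_normal_cone: "closed (regular_normal_cone C x)"
proof -
  have "polar_cone K = (\<Inter>w\<in>K. {v. v \<bullet> w \<le> 0})" for K :: "'a set" by (auto simp: polar_cone_def)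
  moreover have "closed {v. v \<bullet> w \<le> 0}" for w :: 'a
    by (intro closed_Collect_le continuous_intros)
  ultimately show ?thesis unfolding regular_normal_cone_def by auto
qed

lemma regular_subset_normal_cone: "regular_normal_cone C x \<subseteq> normal_cone C x"
proof
  fix v assume v: "v \<in> regular_normal_cone C x"
  then have "x \<in> C" by (auto simp: regular_normal_cone_def split: if_splits)
  with v show "v \<in> normal_cone C x"
    unfolding normal_cone_def by (intro CollectI conjI exI[of _ "\<lambda>_. x"] exI[of _ "\<lambda>_. v"]) auto
qed

text \<open>Fermat's rule on a set: along a tangential sequence \<open>f\<close> eventually cannot
  fall below \<open>f z\<close>, so dividing the first-order expansion by \<open>t k\<close> leaves
  \<open>g \<bullet> w \<ge> 0\<close> for every tangent \<open>w\<close>.\<close>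

lemma local_min_regular_normal:
  fixes f :: "'a::real_inner \<Rightarrow> real"
  assumes z: "z \<in> C" and r: "r > 0"
    and min: "\<And>p. p \<in> C \<Longrightarrow> dist p z < r \<Longrightarrow> f z \<le> f p"
    and der: "(f has_derivative (\<lambda>h. g \<bullet> h)) (at z)"
  shows "- g \<in> regular_normal_cone C z"
proof -
  have "- g \<bullet> w \<le> 0" if "w \<in> tangent_cone C z" for w
  proof -
    obtain t w' where t: "\<And>k::nat. 0 < t k" "t \<longlonglongrightarrow> 0" and w: "w' \<longlonglongrightarrow> w"
      and C: "\<And>k. z + t k *\<^sub>R w' k \<in> C"
      using \<open>w \<in> tangent_cone C z\<close> unfolding tangent_cone_def by blast
    have tw: "(\<lambda>k. t k *\<^sub>R w' k) \<longlonglongrightarrow> 0" using tendsto_scaleR[OF t(2) w] by simp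
    have "0 \<le> g \<bullet> w + e * norm w" if e: "e > 0" for e
    proof -
      obtain d where d: "d > 0"
        "\<And>y. norm (y - z) < d \<Longrightarrow> norm (f y - f z - g \<bullet> (y - z)) \<le> e * norm (y - z)"
        using der e unfolding has_derivative_at_alt by blast
      have "\<forall>\<^sub>F k in sequentially. dist (t k *\<^sub>R w' k) 0 < min d r"
        using tw d(1) r by (intro tendstoD) auto
      then have "\<forall>\<^sub>F k in sequentially. 0 \<le> g \<bullet> w' k + e * norm (w' k)"
      proof eventually_elim
        case (elim k)
        have "f z \<le> f (z + t k *\<^sub>R w' k)"
          using elim by (intro min C) (simp add: dist_norm)
        moreover have "norm (f (z + t k *\<^sub>R w' k) - f z - g \<bullet> (t k *\<^sub>R w' k)) \<le> e * norm (t k *\<^sub>R w' k)"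
          using d(2)[of "z + t k *\<^sub>R w' k"] elim by simp
        ultimately have "0 \<le> g \<bullet> (t k *\<^sub>R w' k) + e * norm (t k *\<^sub>R w' k)" by simp
        also have "\<dots> = t k * (g \<bullet> w' k + e * norm (w' k))"
          using t(1)[of k] by (simp add: algebra_simps)
        finally show ?case using t(1)[of k] by (simp add: zero_le_mult_iff)
      qed
      moreover have "(\<lambda>k. g \<bullet> w' k + e * norm (w' k)) \<longlonglongrightarrow> g \<bullet> w + e * norm w"
        by (intro tendsto_intros w)
      ultimately show ?thesis by (intro tendsto_lowerbound) auto
    qed
    note le = this
    have "0 \<le> g \<bullet> w + e" if "e > 0" for e
    proof -
      have n: "norm w + 1 > 0" by (simp add: add_nonneg_pos)
      have "0 \<le> g \<bullet> w + e / (norm w + 1) * norm w" using that n by (intro le) simp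
      also have "e / (norm w + 1) * norm w \<le> e" using that n by (simp add: field_simps)
      finally show ?thesis by simp
    qed
    then show ?thesis using field_le_epsilon[of 0 "g \<bullet> w"] by simp
  qed
  then show ?thesis using z by (simp add: regular_normal_cone_def polar_cone_def)
qed

text \<open>Smoothing \<open>norm (w - u')\<close> to \<open>sqrt (norm (w - u')\<^sup>2 + \<rho>\<^sup>2)\<close> makes the penalty differentiable,
  so that Fermat's rule produces a regular normal and no nonsmooth sum rule is needed.\<close>

lemma approach_or_normal:
  fixes \<Omega> :: "('a::euclidean_space \<times> 'b::euclidean_space) set"
  assumes cl: "closed (\<Omega> \<inter> cball z0 R)" and z': "(x', u') \<in> \<Omega>" and l: "l > 0" and ne: "x \<noteq> x'"
    and R: "dist (x', u') z0 + (3 + 1 / l) * norm (x - x') < R"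
  obtains y w where "(y, w) \<in> \<Omega>" "dist (y, w) (x', u') \<le> (3 + 1 / l) * norm (x - x')"
    "norm (w - u') \<le> (1 + 1 / l) * norm (x - x')"
    "y = x \<or> (\<exists>v. norm v \<le> l \<and> (sgn (x - y), - v) \<in> regular_normal_cone \<Omega> (y, w))"
proof -
  \<comment> \<open>\<open>\<rho>\<close> is both the initial distance and the smoothing width, so
    that \<open>f (x', u') = \<rho> + l * \<rho>\<close>.\<close>
  define \<rho> where "\<rho> = norm (x - x')"
  define f where "f = (\<lambda>p::'a \<times> 'b. norm (fst p - x) + l * sqrt ((snd p - u') \<bullet> (snd p - u') + \<rho>\<^sup>2))"
  have \<rho>: "\<rho> > 0" using ne by (simp add: \<rho>_def)
  have "compact (\<Omega> \<inter> cball z0 R)"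
    using cl by (simp add: compact_eq_bounded_closed bounded_Int)
  moreover have "(x', u') \<in> \<Omega> \<inter> cball z0 R"
  proof -
    have "0 \<le> (3 + 1 / l) * norm (x - x')" using l by simp
    then have "dist z0 (x', u') \<le> R" using R by (simp add: dist_commute)
    then show ?thesis using z' by simp
  qed
  moreover have "continuous_on (\<Omega> \<inter> cball z0 R) f"
    unfolding f_def by (intro continuous_intros)
  ultimately obtain z where z: "z \<in> \<Omega> \<inter> cball z0 R" and min: "\<And>p. p \<in> \<Omega> \<inter> cball z0 R \<Longrightarrow> f z \<le> f p"
    using continuous_attains_inf[of "\<Omega> \<inter> cball z0 R" f] by blast
  obtain y w where yw: "z = (y, w)" by (cases z)
  define q where "q = sqrt ((w - u') \<bullet> (w - u') + \<rho>\<^sup>2)"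
  have q\<rho>: "q \<ge> \<rho>" unfolding q_def using \<rho> by (intro real_le_rsqrt) auto
  have qw: "q \<ge> norm (w - u')" unfolding q_def by (intro real_le_rsqrt) (auto simp: power2_norm_eq_inner)
  have "f z \<le> f (x', u')" by (rule min) fact
  then have fz: "norm (y - x) + l * q \<le> \<rho> + l * \<rho>"
    using \<rho> by (simp add: f_def yw q_def \<rho>_def norm_minus_commute)
  \<comment> \<open>In \<open>fz\<close>, \<open>q \<ge> \<rho>\<close> cancels the penalty and
    bounds \<open>y - x\<close>, while \<open>q \<ge> norm (w - u')\<close> bounds
    \<open>w - u'\<close>. The factor \<open>3 + 1 / l\<close> below is \<open>2\<close> for
    \<open>y - x'\<close> plus \<open>1 + 1 / l\<close> for \<open>w - u'\<close>.\<close>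
  have "l * \<rho> \<le> l * q" using q\<rho> l by simp
  then have yx: "norm (y - x) \<le> \<rho>" using fz by simp
  have "l * norm (w - u') \<le> l * q" using qw l by simp
  then have "l * norm (w - u') \<le> \<rho> + l * \<rho>" using fz norm_ge_zero[of "y - x"] by linarith
  then have wu: "norm (w - u') \<le> (1 + 1 / l) * \<rho>" using l by (simp add: field_simps)
  have "norm (y - x') \<le> 2 * \<rho>"
    using yx norm_triangle_ineq[of "y - x" "x - x'"] by (simp add: \<rho>_def)
  moreover have "dist (y, w) (x', u') \<le> norm (y - x') + norm (w - u')"
    using norm_Pair_le[of "y - x'" "w - u'"] by (simp add: dist_norm)
  ultimately have d: "dist (y, w) (x', u') \<le> (3 + 1 / l) * \<rho>" using wu by (simp add: algebra_simps)
  have "y = x \<or> (\<exists>v. norm v \<le> l \<and> (sgn (x - y), - v) \<in> regular_normal_cone \<Omega> (y, w))"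
  proof (cases "y = x")
    case False
    \<comment> \<open>The gradient of the smoothed penalty at \<open>w\<close>.\<close>
    define v where "v = (l / q) *\<^sub>R (w - u')"
    have q: "q > 0" using q\<rho> \<rho> by simp
    have "norm v = l * norm (w - u') / q" using q l unfolding v_def norm_scaleR by simp
    also have "\<dots> \<le> l * q / q" using qw q l by (intro divide_right_mono mult_left_mono) auto
    finally have "norm v \<le> l" using q by simp
    moreover have "- (sgn (y - x), v) \<in> regular_normal_cone \<Omega> (y, w)"
    proof (rule local_min_regular_normal)
      \<comment> \<open>The strict inequality makes the ball constraint inactive at the minimiser,
        which is therefore a local minimiser over \<open>\<Omega>\<close>.\<close>
      have dz: "dist z z0 < R"
        using d R dist_triangle[of "(y, w)" z0 "(x', u')"] by (simp add: yw \<rho>_def)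
      then show "R - dist z z0 > 0" by simp
      show "(y, w) \<in> \<Omega>" using z yw by simp
      show "f (y, w) \<le> f p" if "p \<in> \<Omega>" "dist p (y, w) < R - dist z z0" for p
        using min[of p] that dist_triangle[of p z0 z] yw by (auto simp: dist_commute)
      have q0: "(w - u') \<bullet> (w - u') + \<rho>\<^sup>2 > 0" using \<rho> by (simp add: add_nonneg_pos)
      have 1: "((\<lambda>p. norm (fst p - x)) has_derivative (\<lambda>h. fst h \<bullet> sgn (y - x))) (at (y, w))"
      proof -
        have "((\<lambda>p. fst p - x) has_derivative fst) (at (y, w))" by (auto intro!: derivative_eq_intros)
        moreover have "(norm has_derivative (\<lambda>h. h \<bullet> sgn (y - x))) (at (fst (y, w) - x))"
          using has_derivative_norm[of "y - x"] False by simp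
        ultimately show ?thesis by (rule has_derivative_compose)
      qed
      have 2: "((\<lambda>p. sqrt ((snd p - u') \<bullet> (snd p - u') + \<rho>\<^sup>2)) has_derivative
              (\<lambda>h. ((w - u') \<bullet> snd h) / q)) (at (y, w))"
        using q0 by (auto intro!: derivative_eq_intros simp: q_def inner_commute field_simps)
      show "(f has_derivative (\<lambda>h. (sgn (y - x), v) \<bullet> h)) (at (y, w))"
        unfolding f_def
        by (rule has_derivative_eq_rhs[OF has_derivative_add[OF 1 has_derivative_mult_right[OF 2]]])
           (auto simp: v_def inner_prod_def inner_commute)
    qed
    moreover have "- sgn (y - x) = sgn (x - y)" by (metis minus_diff_eq sgn_minus)
    ultimately show ?thesis by auto
  qed simp
  then show thesis using that d wu z unfolding \<rho>_def yw by blast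
qed

section \<open>Projections onto tangent cones\<close>

text \<open>A tangent cone is closed under positive scaling, so a nearest point \<open>t\<close>
  also minimises the distance to \<open>a\<close> along its own ray, which forces
  \<open>t - a\<close> orthogonal to \<open>t\<close>. The factor \<open>UNIV\<close> lets the
  second component be matched exactly.\<close>

lemma proj_set_tangent_cone:
  fixes X :: "'a::real_inner set" and Z :: "('a \<times> 'b::real_inner) set"
  assumes "(t, p) \<in> proj_set (tangent_cone X x \<times> UNIV) Z"
  obtains a where "(a, p) \<in> Z" "t \<in> tangent_cone X x" "a \<bullet> t = (norm t)\<^sup>2" "norm t \<le> norm a"
proof -
  obtain a b where Z: "(a, b) \<in> Z" and t: "t \<in> tangent_cone X x"
    and d: "norm ((t, p) - (a, b)) = infdist (a, b) (tangent_cone X x \<times> UNIV)"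
    using assms unfolding proj_set_def by auto
  have le: "norm ((t, p) - (a, b)) \<le> norm (s - a)" if "s \<in> tangent_cone X x" for s
    using infdist_le[of "(s, b)" "tangent_cone X x \<times> UNIV" "(a, b)"] that d
    by (simp add: dist_norm norm_minus_commute norm_Pair)
  have "p = b" using sqrt_le_D[OF le[OF t, unfolded norm_Pair diff_Pair fst_conv snd_conv]] by simp
  then have le': "norm (t - a) \<le> norm (s - a)" if "s \<in> tangent_cone X x" for s
    using le[OF that] by (simp add: norm_Pair)
  define c where "c = (t - a) \<bullet> t"
  \<comment> \<open>\<open>N\<close> dominates \<open>\<bar>c\<bar>\<close> and
    \<open>(norm t)\<^sup>2\<close>. Hence the choice of \<open>h\<close> keeps \<open>1 + h\<close>
    positive, and \<open>2 * h * c + h\<^sup>2 * N\<close> is negative unless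
    \<open>c = 0\<close>.\<close>
  define N where "N = \<bar>c\<bar> + (norm t)\<^sup>2 + 1"
  define h where "h = - c / (2 * N)"
  have N: "N > 0" "\<bar>c\<bar> \<le> N" "(norm t)\<^sup>2 \<le> N" by (auto simp: N_def add_nonneg_pos)
  have "c / (2 * N) < 1" using N by (subst divide_less_eq_1_pos) auto
  then have h: "h > -1" by (simp add: h_def)
  have "norm (t - a) \<le> norm ((1 + h) *\<^sub>R t - a)"
    using h by (intro le' tangent_cone_scaleR t) auto
  then have "(norm (t - a))\<^sup>2 \<le> (norm ((t - a) + h *\<^sub>R t))\<^sup>2" by (simp add: algebra_simps)
  then have "0 \<le> 2 * h * c + h\<^sup>2 * (norm t)\<^sup>2"
    unfolding c_def power2_norm_eq_inner
    by (simp add: inner_add_left inner_add_right inner_commute power2_eq_square algebra_simps)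
  also have "\<dots> \<le> 2 * h * c + h\<^sup>2 * N" using N by (intro add_left_mono mult_left_mono) auto
  also have "\<dots> = - (3 / (4 * N)) * c\<^sup>2" using N(1) by (simp add: h_def field_simps power2_eq_square)
  finally have "c\<^sup>2 \<le> 0" using N(1) by (simp add: zero_le_mult_iff divide_le_0_iff)
  then have at: "a \<bullet> t = (norm t)\<^sup>2" by (simp add: c_def inner_diff_left power2_norm_eq_inner)
  have "norm t * norm t \<le> norm a * norm t"
    using norm_cauchy_schwarz[of a t] at by (simp add: power2_eq_square)
  then have "norm t \<le> norm a" by (cases "t = 0") auto
  then show thesis using that Z t at \<open>p = b\<close> by blast
qed

lemma proj_set_memI: "z \<in> C \<Longrightarrow> z \<in> Z \<Longrightarrow> z \<in> proj_set C Z"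
  unfolding proj_set_def by (auto intro!: bexI[of _ z])

section \<open>Graph, domain and the tangents supplied by (i)\<close>

lemma restrict_to_sdom [simp]: "restrict_to S (sdom S) = S"
  by (auto simp: restrict_to_def sdom_def fun_eq_iff)

lemma gph_iff [simp]: "(x, u) \<in> gph S \<longleftrightarrow> u \<in> S x"
  by (simp add: gph_def)

text \<open>Discharges the domain premise of (ii) for every tangent of the graph.\<close>

lemma fst_tangent_cone_gph:
  assumes "(x, u) \<in> tangent_cone (gph S) (x0, u0)"
  shows "x \<in> tangent_cone (sdom S) x0"
proof -
  obtain t w where g: "u0 \<in> S x0" and t: "\<And>k::nat. 0 < t k" "t \<longlonglongrightarrow> 0" and w: "w \<longlonglongrightarrow> (x, u)"
    and C: "\<And>k. (x0, u0) + t k *\<^sub>R w k \<in> gph S"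
    using assms unfolding tangent_cone_def by auto
  show ?thesis
  proof (rule tangent_coneI_seq)
    show "(\<lambda>k. fst (w k)) \<longlonglongrightarrow> x" using tendsto_fst[OF w] by simp
    show "x0 + t k *\<^sub>R fst (w k) \<in> sdom S" for k
      using C[of k] by (cases "w k") (auto simp: sdom_def)
  qed (use t g in \<open>auto simp: sdom_def\<close>)
qed

text \<open>Turns (i) into graph tangents. A vanishing liminf yields arbitrarily late
  \<open>k\<close> with distance below \<open>e * t k\<close>; a nearly nearest point
  \<open>p\<close> of \<open>C\<close> then has its difference quotient \<open>(p - z) / t k\<close>
  within \<open>e\<close> of \<open>w\<close>.\<close>

lemma tangent_cone_if_liminf:
  fixes C :: "'a::real_normed_vector set"
  assumes z: "z \<in> C" and t: "\<And>k::nat. 0 < t k" "t \<longlonglongrightarrow> 0"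
    and lim: "liminf (\<lambda>k. ereal (infdist (z + t k *\<^sub>R w) C / t k)) = 0"
  shows "w \<in> tangent_cone C z"
  unfolding tangent_cone_iff
proof (intro conjI allI impI)
  fix e :: real assume e: "e > 0"
  have "\<exists>\<^sub>F k in sequentially. infdist (z + t k *\<^sub>R w) C / t k < e"
  proof (rule ccontr)
    assume "\<not> ?thesis"
    then have "\<forall>\<^sub>F k in sequentially. ereal e \<le> ereal (infdist (z + t k *\<^sub>R w) C / t k)"
      by (simp add: not_frequently not_less)
    from Liminf_bounded[OF this] have "ereal e \<le> 0" by (simp only: lim)
    then show False using e by simp
  qed
  moreover have "\<forall>\<^sub>F k in sequentially. t k < e" using t(2) e by (rule order_tendstoD)
  ultimately have "\<exists>\<^sub>F k in sequentially. infdist (z + t k *\<^sub>R w) C / t k < e \<and> t k < e"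
    by (rule frequently_eventually_frequently)
  then obtain k where k: "infdist (z + t k *\<^sub>R w) C / t k < e" "t k < e"
    by (auto dest: frequently_ex)
  have ne: "C \<noteq> {}" using z by blast
  from k have "infdist (z + t k *\<^sub>R w) C < e * t k" using t(1)[of k] by (simp add: field_simps)
  then obtain p where p: "p \<in> C" "dist (z + t k *\<^sub>R w) p < e * t k"
    unfolding infdist_notempty[OF ne] cINF_less_iff[OF ne bdd_below_image_dist] by blast
  define w' where "w' = (1 / t k) *\<^sub>R (p - z)"
  have tw: "t k *\<^sub>R w' = p - z" using t(1)[of k] by (simp add: w'_def)
  have "t k * dist w' w = norm (t k *\<^sub>R (w' - w))" using t(1)[of k] by (simp add: dist_norm)
  also have "\<dots> = dist (z + t k *\<^sub>R w) p"
    by (simp add: scaleR_diff_right tw dist_norm norm_minus_commute algebra_simps)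
  finally have "t k * dist w' w < t k * e" using p(2) by (simp add: mult.commute)
  then have "dist w' w < e" using t(1)[of k] by simp
  moreover have "z + t k *\<^sub>R w' \<in> C" using tw p by simp
  ultimately show "\<exists>t w'. 0 < t \<and> t < e \<and> dist w' w < e \<and> z + t *\<^sub>R w' \<in> C"
    using t(1) k by blast
qed (fact z)

section \<open>Estimates for normals to the graph\<close>

text \<open>Compactness turns triviality of the directional coderivatives into a uniform estimate for the
  regular normals at all nearby points of the graph other than the reference point.\<close>

lemma regular_normals_near:
  fixes S :: "'a::euclidean_space \<Rightarrow> 'b::euclidean_space set"
  assumes z0: "z0 \<in> gph S"
    and dir: "\<And>d. d \<in> tangent_cone (gph S) z0 \<Longrightarrow> d \<noteq> 0 \<Longrightarrow> dir_coderivative S z0 d 0 = {0}"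
  obtains \<epsilon> l where "\<epsilon> > 0" "l > 0"
    "\<And>z a v. z \<in> gph S \<Longrightarrow> z \<noteq> z0 \<Longrightarrow> dist z z0 < \<epsilon> \<Longrightarrow> (a, v) \<in> regular_normal_cone (gph S) z \<Longrightarrow>
       l * norm a \<le> norm v"
proof -
  \<comment> \<open>One \<open>\<delta>\<close> serves as radius and as slope, so the negation can
    be sampled along a single null sequence.\<close>
  have "\<exists>\<delta>>0. \<forall>z a v. z \<in> gph S \<longrightarrow> z \<noteq> z0 \<longrightarrow> dist z z0 < \<delta> \<longrightarrow> (a, v) \<in> regular_normal_cone (gph S) z \<longrightarrow>
       \<delta> * norm a \<le> norm v"
  proof (rule ccontr)
    assume H: "\<not> ?thesis"
    have "\<forall>k. \<exists>z a v. z \<in> gph S \<and> z \<noteq> z0 \<and> dist z z0 < inverse (real (Suc k)) \<and>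
       (a, v) \<in> regular_normal_cone (gph S) z \<and> norm v < inverse (real (Suc k)) * norm a"
      using H by (auto simp: not_le simp del: of_nat_Suc)
    then obtain z a v where z: "\<And>k. z k \<in> gph S" "\<And>k. z k \<noteq> z0" "\<And>k. dist (z k) z0 < inverse (real (Suc k))"
      and n: "\<And>k. (a k, v k) \<in> regular_normal_cone (gph S) (z k)"
      and v: "\<And>k. norm (v k) < inverse (real (Suc k)) * norm (a k)"
      by metis
    have a0: "norm (a k) > 0" for k using v[of k] norm_ge_zero[of "v k"] by (cases "a k = 0") auto
    define t where "t k = norm (z k - z0)" for k
    have t0: "t k > 0" for k using z(2) by (simp add: t_def)
    have t: "t \<longlonglongrightarrow> 0"
      by (rule tendsto_0_if_le_inverse)
         (use z(3) in \<open>simp add: t_def dist_norm less_imp_le del: of_nat_Suc\<close>)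
    \<comment> \<open>After scaling to unit length, a subsequence gives a unit tangent direction
      \<open>D\<close> and a unit vector \<open>B\<close>. As \<open>v k\<close> divided by
      \<open>norm (a k)\<close> tends to 0, \<open>B\<close> belongs to the coderivative that (ii)
      makes trivial.\<close>
    define d where "d k = sgn (z k - z0)" for k
    define b where "b k = sgn (a k)" for k
    have td: "z0 + t k *\<^sub>R d k = z k" for k using z(2)[of k] by (simp add: t_def d_def sgn_div_norm)
    have mem: "\<forall>k. (d k, b k) \<in> sphere 0 1 \<times> sphere 0 1"
      using z(2) a0 by (simp add: d_def b_def norm_sgn)
    have "compact (sphere (0::'a \<times> 'b) 1 \<times> sphere (0::'a) 1)" by (intro compact_Times compact_sphere)
    then have "seq_compact (sphere (0::'a \<times> 'b) 1 \<times> sphere (0::'a) 1)" by (rule compact_imp_seq_compact)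
    from this mem obtain p r where p: "p \<in> sphere (0::'a \<times> 'b) 1 \<times> sphere (0::'a) 1" and r: "strict_mono r"
      and lim: "((\<lambda>k. (d k, b k)) \<circ> r) \<longlonglongrightarrow> p"
      by (rule seq_compactE)
    obtain D B where DB: "p = (D, B)" "norm D = 1" "norm B = 1" using p by (cases p) auto
    have dl: "(\<lambda>k. d (r k)) \<longlonglongrightarrow> D" and bl: "(\<lambda>k. b (r k)) \<longlonglongrightarrow> B"
      using tendsto_fst[OF lim] tendsto_snd[OF lim] by (simp_all add: DB o_def)
    have tl: "(\<lambda>k. t (r k)) \<longlonglongrightarrow> 0" using LIMSEQ_subseq_LIMSEQ[OF t r] by (simp add: o_def)
    have "D \<in> tangent_cone (gph S) z0"
      by (rule tangent_coneI_seq[OF z0 t0 tl dl]) (simp add: td z(1))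
    then have "dir_coderivative S z0 D 0 = {0}" using DB by (intro dir) auto
    moreover have "B \<in> dir_coderivative S z0 D 0"
      unfolding dir_coderivative_def dir_normal_cone_def outer_limit_def
    proof (intro CollectI exI conjI allI)
      show "filterlim (\<lambda>k. (t (r k), d (r k))) (at_right 0 \<times>\<^sub>F nhds D) sequentially"
        using tl dl t0 by (intro filterlim_Pair) (auto simp: filterlim_at less_imp_neq[symmetric])
      show "(b (r k), v (r k) /\<^sub>R norm (a (r k))) \<in>
          (case (t (r k), d (r k)) of (t, d') \<Rightarrow> regular_normal_cone (gph S) (z0 + t *\<^sub>R d'))" for k
        using regular_normal_cone_scaleR[OF n[of "r k"], of "inverse (norm (a (r k)))"]
        by (simp add: td b_def sgn_div_norm)
      have "(\<lambda>k. v k /\<^sub>R norm (a k)) \<longlonglongrightarrow> 0"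
      proof (rule tendsto_0_if_le_inverse)
        show "norm (v k /\<^sub>R norm (a k)) \<le> inverse (real (Suc k))" for k
          using v[of k] a0[of k] by (simp add: field_simps del: of_nat_Suc)
      qed
      then have "(\<lambda>k. v (r k) /\<^sub>R norm (a (r k))) \<longlonglongrightarrow> - 0"
        using LIMSEQ_subseq_LIMSEQ[OF _ r] unfolding o_def minus_zero by fast
      then show "(\<lambda>k. (b (r k), v (r k) /\<^sub>R norm (a (r k)))) \<longlonglongrightarrow> (B, - 0)"
        by (intro tendsto_Pair bl)
    qed
    ultimately show False using DB by auto
  qed
  then show thesis using that by blast
qed

text \<open>The estimate is a closed condition and the regular normal cone at \<open>z0\<close> is a
  closed set, so both survive the limit defining \<open>normal_cone\<close>. Only for
  \<open>z = z0\<close> can infinitely many approximating base points equal \<open>z0\<close>, which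
  explains the second alternative.\<close>

lemma normal_cone_near:
  fixes \<Omega> :: "('a::real_inner \<times> 'b::real_inner) set"
  assumes near: "\<And>z a v. z \<in> \<Omega> \<Longrightarrow> z \<noteq> z0 \<Longrightarrow> dist z z0 < \<epsilon> \<Longrightarrow> (a, v) \<in> regular_normal_cone \<Omega> z \<Longrightarrow>
       l * norm a \<le> norm v"
    and n: "(a, v) \<in> normal_cone \<Omega> z" and z: "dist z z0 < \<epsilon>"
  shows "l * norm a \<le> norm v \<or> z = z0 \<and> (a, v) \<in> regular_normal_cone \<Omega> z0"
proof -
  obtain x p where x: "x \<longlonglongrightarrow> z" and p: "p \<longlonglongrightarrow> (a, v)" and \<Omega>: "\<And>k::nat. x k \<in> \<Omega>"
    and reg: "\<And>k. p k \<in> regular_normal_cone \<Omega> (x k)"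
    using n unfolding normal_cone_def by blast
  define A where "A = {q::'a \<times> 'b. l * norm (fst q) \<le> norm (snd q)}"
  have cl: "closed (A \<union> regular_normal_cone \<Omega> z0)" "closed A"
    unfolding A_def by (intro closed_Un closed_regular_normal_cone closed_Collect_le continuous_intros)+
  have A: "p k \<in> A" if "x k \<noteq> z0" "dist (x k) z0 < \<epsilon>" for k
    using near[OF \<Omega>[of k] that, of "fst (p k)" "snd (p k)"] reg[of k] by (simp add: A_def)
  have "(\<lambda>k. dist (x k) z0) \<longlonglongrightarrow> dist z z0" by (intro tendsto_intros x)
  then have ev: "\<forall>\<^sub>F k in sequentially. dist (x k) z0 < \<epsilon>" using z by (rule order_tendstoD)
  show ?thesis
  proof (cases "z = z0")
    case True
    from ev have "\<forall>\<^sub>F k in sequentially. p k \<in> A \<union> regular_normal_cone \<Omega> z0"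
    proof eventually_elim
      case (elim k)
      then show ?case using A[of k] reg[of k] by (cases "x k = z0") auto
    qed
    then have "(a, v) \<in> A \<union> regular_normal_cone \<Omega> z0"
      using p cl(1) by (intro Lim_in_closed_set) auto
    then show ?thesis using True by (auto simp: A_def)
  next
    case False
    have "\<forall>\<^sub>F k in sequentially. x k \<noteq> z0" using x False by (rule tendsto_imp_eventually_ne)
    with ev have "\<forall>\<^sub>F k in sequentially. p k \<in> A" by eventually_elim (rule A)
    then have "(a, v) \<in> A" using p cl(2) by (intro Lim_in_closed_set) auto
    then show ?thesis by (simp add: A_def)
  qed
qed

text \<open>If the graph contains points near \<open>z0\<close> that lie steeply over \<open>x0\<close>, then the normal estimate at
  such a point forces the domain to contain a ball around its base that reaches \<open>x0\<close>.\<close>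

lemma steep_or_interior:
  fixes S :: "'a::euclidean_space \<Rightarrow> 'b::euclidean_space set"
  assumes cl: "closed (gph S \<inter> cball (x0, u0) R)" and R: "R > 0" and l: "l > 0"
    and near: "\<And>z a v. z \<in> gph S \<Longrightarrow> z \<noteq> (x0, u0) \<Longrightarrow> dist z (x0, u0) < R \<Longrightarrow>
       (a, v) \<in> regular_normal_cone (gph S) z \<Longrightarrow> l * norm a \<le> norm v"
  obtains "x0 \<in> interior (sdom S)"
  | M where "M > 0" "\<And>x u. u \<in> S x \<Longrightarrow> dist (x, u) (x0, u0) < R / 2 \<Longrightarrow> dist (x, u) (x0, u0) \<le> M * norm (x - x0)"
proof -
  \<comment> \<open>Strictly below \<open>l\<close>, so that a normal with unit first component and
    second component of norm at most \<open>l'\<close> violates the estimate. \<open>M\<close> is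
    the matching constant of \<open>approach_or_normal\<close>.\<close>
  define l' where "l' = l / 2"
  define M where "M = 3 + 1 / l'"
  have l': "0 < l'" "l' < l" using l by (auto simp: l'_def)
  then have M: "M > 0" by (simp add: M_def add_pos_pos)
  show thesis
  proof (cases "\<exists>x u. u \<in> S x \<and> dist (x, u) (x0, u0) < R / 2 \<and> M * norm (x - x0) < dist (x, u) (x0, u0)")
    case True
    then obtain x' u' where xu: "u' \<in> S x'" "dist (x', u') (x0, u0) < R / 2"
      "M * norm (x' - x0) < dist (x', u') (x0, u0)" by blast
    define \<rho> where "\<rho> = dist (x', u') (x0, u0)"
    \<comment> \<open>The radius \<open>\<rho> / M\<close> keeps \<open>(y, w)\<close> closer than
      \<open>\<rho>\<close> to \<open>(x', u')\<close>, hence away from \<open>(x0, u0)\<close>,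
      where \<open>near\<close> says nothing; \<open>\<rho> < R / 2\<close> keeps it within
      \<open>R\<close>. Steepness says exactly that \<open>x0\<close> lies in this ball.\<close>
    have "x \<in> sdom S" if x: "x \<in> ball x' (\<rho> / M)" for x
    proof (cases "x = x'")
      case False
      have Mx: "M * norm (x - x') < \<rho>"
        using x M by (simp add: dist_norm norm_minus_commute field_simps)
      obtain y w where yw: "(y, w) \<in> gph S" "dist (y, w) (x', u') \<le> M * norm (x - x')"
        "y = x \<or> (\<exists>v. norm v \<le> l' \<and> (sgn (x - y), - v) \<in> regular_normal_cone (gph S) (y, w))"
      proof (rule approach_or_normal[OF cl, of x' u' l' x])
        show "dist (x', u') (x0, u0) + (3 + 1 / l') * norm (x - x') < R"
          using Mx xu unfolding \<rho>_def M_def by simp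
      qed (use xu l' False that in \<open>auto simp: M_def\<close>)
      have "y = x"
      proof (rule ccontr)
        assume "y \<noteq> x"
        then obtain v where v: "norm v \<le> l'" "(sgn (x - y), - v) \<in> regular_normal_cone (gph S) (y, w)"
          using yw(3) by blast
        have "(y, w) \<noteq> (x0, u0)" using yw(2) Mx by (auto simp: \<rho>_def dist_commute)
        moreover have "dist (y, w) (x0, u0) < R"
          using yw(2) Mx xu(2) dist_triangle[of "(y, w)" "(x0, u0)" "(x', u')"] by (simp add: \<rho>_def)
        ultimately have "l * norm (sgn (x - y)) \<le> norm (- v)" using near v(2) yw(1) by blast
        then show False using v(1) l' \<open>y \<noteq> x\<close> by (simp add: norm_sgn)
      qed
      then show ?thesis using yw(1) by (auto simp: sdom_def)
    qed (use xu in \<open>auto simp: sdom_def\<close>)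
    then have "ball x' (\<rho> / M) \<subseteq> sdom S" by blast
    moreover have "x0 \<in> ball x' (\<rho> / M)"
      using xu(3) M by (simp add: \<rho>_def dist_norm field_simps)
    ultimately have "x0 \<in> interior (sdom S)" by (meson interiorI open_ball)
    then show thesis by (rule that(1))
  next
    case False
    then show thesis using that(2)[OF M] by (meson not_le)
  qed
qed

text \<open>Covers the one point that the compactness argument leaves out. The two conditions tying
  \<open>t\<close> to \<open>a\<close> are those delivered by
  \<open>proj_set_tangent_cone\<close>.\<close>

lemma regular_normals_at:
  fixes S :: "'a::euclidean_space \<Rightarrow> 'b::euclidean_space set"
  assumes cl: "closed (gph S \<inter> cball (x0, u0) R)" and R: "R > 0" and l: "l > 0"
    and near: "\<And>z a v. z \<in> gph S \<Longrightarrow> z \<noteq> (x0, u0) \<Longrightarrow> dist z (x0, u0) < R \<Longrightarrow>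
       (a, v) \<in> regular_normal_cone (gph S) z \<Longrightarrow> l * norm a \<le> norm v"
    and tan: "\<And>x. x \<in> tangent_cone (sdom S) x0 \<Longrightarrow> \<exists>u. (x, u) \<in> tangent_cone (gph S) (x0, u0)"
  obtains \<mu> where "\<mu> > 0"
    "\<And>a v t. (a, v) \<in> regular_normal_cone (gph S) (x0, u0) \<Longrightarrow> t \<in> tangent_cone (sdom S) x0 \<Longrightarrow>
       a \<bullet> t = (norm t)\<^sup>2 \<Longrightarrow> norm t \<le> norm a \<Longrightarrow> \<mu> * norm t \<le> norm v"
proof -
  have pol: "a \<bullet> x + v \<bullet> u \<le> 0"
    if "(a, v) \<in> regular_normal_cone (gph S) (x0, u0)" "(x, u) \<in> tangent_cone (gph S) (x0, u0)" for a v x u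
    using that by (force simp: regular_normal_cone_def polar_cone_def split: if_splits)
  consider (1) "x0 \<in> interior (sdom S)"
    | (2) M where "M > 0"
      "\<And>x u. u \<in> S x \<Longrightarrow> dist (x, u) (x0, u0) < R / 2 \<Longrightarrow> dist (x, u) (x0, u0) \<le> M * norm (x - x0)"
    by (rule steep_or_interior[OF cl R l]) (use near in blast)+
  then show thesis
  proof cases
    case 1
    then have "\<forall>x. \<exists>u. (x, u) \<in> tangent_cone (gph S) (x0, u0)" using tan tangent_cone_interior by blast
    then obtain U where U: "\<And>x. (x, U x) \<in> tangent_cone (gph S) (x0, u0)" by metis
    \<comment> \<open>Polarity against the tangents over \<open>i\<close> and \<open>- i\<close>
      bounds \<open>\<bar>a \<bullet> i\<bar>\<close> by \<open>norm v\<close> times the sum of the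
      norms of their second components; \<open>C\<close> adds this up for the l1 bound on
      \<open>a\<close>.\<close>
    define C where "C = (\<Sum>i\<in>Basis. norm (U i) + norm (U (- i)))"
    have C: "C \<ge> 0" by (auto simp: C_def intro!: sum_nonneg add_nonneg_nonneg)
    have bound: "norm a \<le> C * norm v" if "(a, v) \<in> regular_normal_cone (gph S) (x0, u0)" for a v
    proof -
      have "\<bar>a \<bullet> i\<bar> \<le> norm v * (norm (U i) + norm (U (- i)))" for i
        using pol[OF that U[of i]] pol[OF that U[of "- i"]]
          norm_cauchy_schwarz[of "- v" "U i"] norm_cauchy_schwarz[of "- v" "U (- i)"]
        by (simp add: distrib_left abs_le_iff)
           (smt (verit) mult_nonneg_nonneg norm_ge_zero)
      then have "(\<Sum>i\<in>Basis. \<bar>a \<bullet> i\<bar>) \<le> norm v * C"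
        unfolding C_def sum_distrib_left by (intro sum_mono)
      then show ?thesis using norm_le_l1[of a] by (simp add: mult.commute)
    qed
    show thesis
    proof (rule that[of "1 / (C + 1)"])
      fix a v t assume n: "(a, v) \<in> regular_normal_cone (gph S) (x0, u0)" and "norm t \<le> norm a"
      have "norm t \<le> (C + 1) * norm v"
        using bound[OF n] \<open>norm t \<le> norm a\<close> by (simp add: distrib_right)
          (smt (verit) norm_ge_zero)
      then show "1 / (C + 1) * norm t \<le> norm v" using C by (simp add: field_simps)
    qed (use C in simp)
  next
    case (2 M)
    show thesis
    proof (rule that[of "1 / M"])
      fix a v t assume n: "(a, v) \<in> regular_normal_cone (gph S) (x0, u0)"
        and t: "t \<in> tangent_cone (sdom S) x0" "a \<bullet> t = (norm t)\<^sup>2"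
      \<comment> \<open>Graph points near the reference point obey the slope bound \<open>M\<close>.
        The bound is homogeneous, so dividing by \<open>s k\<close> and passing to the limit gives
        it for the tangent \<open>(t, u)\<close>.\<close>
      obtain u where u: "(t, u) \<in> tangent_cone (gph S) (x0, u0)" using tan t by blast
      then obtain s w where s: "\<And>k::nat. 0 < s k" "s \<longlonglongrightarrow> 0" and w: "w \<longlonglongrightarrow> (t, u)"
        and g: "\<And>k. (x0, u0) + s k *\<^sub>R w k \<in> gph S"
        unfolding tangent_cone_def by blast
      have "(\<lambda>k. s k *\<^sub>R w k) \<longlonglongrightarrow> 0"
        using tendsto_scaleR[OF s(2) w] unfolding scaleR_zero_left .
      then have "\<forall>\<^sub>F k in sequentially. dist (s k *\<^sub>R w k) 0 < R / 2" using R by (intro tendstoD) auto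
      then have "\<forall>\<^sub>F k in sequentially. norm (w k) \<le> M * norm (fst (w k))"
      proof eventually_elim
        case (elim k)
        have "dist ((x0, u0) + s k *\<^sub>R w k) (x0, u0) = s k * norm (w k)"
          using s(1)[of k] by (simp add: dist_norm)
        moreover have "dist ((x0, u0) + s k *\<^sub>R w k) (x0, u0) < R / 2"
          using elim by (simp add: dist_norm)
        ultimately have "s k * norm (w k) \<le> M * norm (s k *\<^sub>R fst (w k))"
          using 2(2)[of "u0 + s k *\<^sub>R snd (w k)" "x0 + s k *\<^sub>R fst (w k)"] g[of k]
          by (cases "w k") simp
        then show ?case using s(1)[of k] by (simp add: mult.left_commute)
      qed
      then have "norm (t, u) \<le> M * norm (fst (t, u))"
        by (rule tendsto_le[OF sequentially_bot tendsto_mult_left[OF tendsto_norm[OF tendsto_fst[OF w]]]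
              tendsto_norm[OF w]])
      then have "norm u \<le> M * norm t" using order_trans[OF norm_snd_le] by simp
      then have "norm v * norm u \<le> norm v * (M * norm t)" by (intro mult_left_mono) auto
      moreover have "(norm t)\<^sup>2 \<le> norm v * norm u"
        using pol[OF n u] t(2) norm_cauchy_schwarz[of "- v" u] by simp
      ultimately have "norm t * norm t \<le> (M * norm v) * norm t"
        by (simp add: power2_eq_square mult_ac)
      then have "norm t \<le> M * norm v" using 2(1) by (cases "t = 0") auto
      then show "1 / M * norm t \<le> norm v" using 2(1) by (simp add: field_simps)
    qed (use 2 in simp)
  qed
qed

text \<open>The estimate that feeds both conclusions. Limiting normals split by
  \<open>normal_cone_near\<close>: on the first branch projection does not lengthen
  \<open>a\<close>, on the second \<open>regular_normals_at\<close> applies.\<close>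

lemma projected_normals:
  fixes S :: "'a::euclidean_space \<Rightarrow> 'b::euclidean_space set"
  assumes cl: "closed (gph S \<inter> cball (x0, u0) R)" and R: "R > 0" and u0: "u0 \<in> S x0"
    and tan: "\<And>x. x \<in> tangent_cone (sdom S) x0 \<Longrightarrow> \<exists>u. (x, u) \<in> tangent_cone (gph S) (x0, u0)"
    and dir: "\<And>d. d \<in> tangent_cone (gph S) (x0, u0) \<Longrightarrow> d \<noteq> 0 \<Longrightarrow> dir_coderivative S (x0, u0) d 0 = {0}"
  obtains \<epsilon> c where "\<epsilon> > 0" "c > 0"
    "\<And>x u t p. dist (x, u) (x0, u0) < \<epsilon> \<Longrightarrow>
       (t, p) \<in> proj_set (tangent_cone (sdom S) x \<times> UNIV) (normal_cone (gph S) (x, u)) \<Longrightarrow>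
       c * norm t \<le> norm p"
proof -
  obtain e l where e: "e > 0" and l: "l > 0"
    and near: "\<And>z a v. z \<in> gph S \<Longrightarrow> z \<noteq> (x0, u0) \<Longrightarrow> dist z (x0, u0) < e \<Longrightarrow>
       (a, v) \<in> regular_normal_cone (gph S) z \<Longrightarrow> l * norm a \<le> norm v"
    by (rule regular_normals_near[of "(x0, u0)" S]) (use u0 dir in auto)
  define \<epsilon> where "\<epsilon> = min e R"
  have \<epsilon>: "\<epsilon> > 0" "\<epsilon> \<le> e" using e R by (auto simp: \<epsilon>_def)
  have "gph S \<inter> cball (x0, u0) \<epsilon> = (gph S \<inter> cball (x0, u0) R) \<inter> cball (x0, u0) \<epsilon>"
    by (auto simp: \<epsilon>_def)
  then have cl': "closed (gph S \<inter> cball (x0, u0) \<epsilon>)" using cl by (metis closed_Int closed_cball)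
  note near' = near[OF _ _ less_le_trans[OF _ \<epsilon>(2)]]
  obtain \<mu> where \<mu>: "\<mu> > 0" and at:
    "\<And>a v t. (a, v) \<in> regular_normal_cone (gph S) (x0, u0) \<Longrightarrow> t \<in> tangent_cone (sdom S) x0 \<Longrightarrow>
       a \<bullet> t = (norm t)\<^sup>2 \<Longrightarrow> norm t \<le> norm a \<Longrightarrow> \<mu> * norm t \<le> norm v"
    by (rule regular_normals_at[OF cl' \<epsilon>(1) l]) (use near' tan in blast)+
  show thesis
  proof (rule that[of \<epsilon> "min l \<mu>"])
    fix x u t p assume d: "dist (x, u) (x0, u0) < \<epsilon>"
      and tp: "(t, p) \<in> proj_set (tangent_cone (sdom S) x \<times> UNIV) (normal_cone (gph S) (x, u))"
    obtain a where a: "(a, p) \<in> normal_cone (gph S) (x, u)" "t \<in> tangent_cone (sdom S) x"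
      "a \<bullet> t = (norm t)\<^sup>2" "norm t \<le> norm a"
      using tp by (rule proj_set_tangent_cone)
    consider "l * norm a \<le> norm p" | "x = x0" "(a, p) \<in> regular_normal_cone (gph S) (x0, u0)"
    proof -
      have "l * norm a \<le> norm p \<or>
          (x, u) = (x0, u0) \<and> (a, p) \<in> regular_normal_cone (gph S) (x0, u0)"
        by (rule normal_cone_near[OF _ a(1) d]) (rule near')
      then show thesis using that by blast
    qed
    then show "min l \<mu> * norm t \<le> norm p"
    proof cases
      case 1
      have "min l \<mu> * norm t \<le> l * norm a" using a(4) l by (intro mult_mono) auto
      with 1 show ?thesis by simp
    next
      case 2
      have "min l \<mu> * norm t \<le> \<mu> * norm t" by (intro mult_right_mono) auto
      also have "\<dots> \<le> norm p" using 2 a by (intro at) auto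
      finally show ?thesis .
    qed
  qed (use \<epsilon> l \<mu> in auto)
qed

section \<open>The coderivative criterion and the Lipschitz-like property\<close>

text \<open>The estimate is preserved under limits, so a limit with second component 0 has first
  component 0.\<close>

lemma proj_coderivative_zero:
  fixes S :: "'a::real_inner \<Rightarrow> 'b::real_inner set"
  assumes u0: "u0 \<in> S x0" and \<epsilon>: "\<epsilon> > 0" and c: "c > 0"
    and est: "\<And>x u t p. dist (x, u) (x0, u0) < \<epsilon> \<Longrightarrow>
       (t, p) \<in> proj_set (tangent_cone (sdom S) x \<times> UNIV) (normal_cone (gph S) (x, u)) \<Longrightarrow>
       c * norm t \<le> norm p"
  shows "proj_coderivative S (sdom S) x0 u0 0 = {0}"
proof -
  have "t = 0" if t: "t \<in> proj_coderivative S (sdom S) x0 u0 0" for t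
  proof -
    obtain y v where y: "filterlim y (inf (nhds (x0, u0)) (principal (gph S))) sequentially"
      and v: "\<And>k::nat. v k \<in> (case y k of (x', u') \<Rightarrow>
          proj_set (tangent_cone (sdom S) x' \<times> UNIV) (normal_cone (gph S) (x', u')))"
      and lim: "v \<longlonglongrightarrow> (t, 0)"
      using t unfolding proj_coderivative_def outer_limit_def by auto
    have "y \<longlonglongrightarrow> (x0, u0)" using y by (simp add: filterlim_inf)
    then have "\<forall>\<^sub>F k in sequentially. dist (y k) (x0, u0) < \<epsilon>" using \<epsilon> by (rule tendstoD)
    then have "\<forall>\<^sub>F k in sequentially. c * norm (fst (v k)) \<le> norm (snd (v k))"
    proof eventually_elim
      case (elim k)
      then show ?case using v[of k] by (cases "y k", cases "v k") (auto intro: est)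
    qed
    then have "c * norm (fst (t, 0::'b)) \<le> norm (snd (t, 0::'b))"
      by (rule tendsto_le[OF sequentially_bot tendsto_norm[OF tendsto_snd[OF lim]]
            tendsto_mult_left[OF tendsto_norm[OF tendsto_fst[OF lim]]]])
    then show ?thesis using c by (simp add: mult_le_0_iff)
  qed
  moreover have "0 \<in> proj_coderivative S (sdom S) x0 u0 0"
    unfolding proj_coderivative_def outer_limit_def
  proof (intro CollectI exI conjI allI)
    have x0: "x0 \<in> sdom S" using u0 by (auto simp: sdom_def)
    \<comment> \<open>The constant sequence is admissible because the filter retains the limit
      point.\<close>
    show "filterlim (\<lambda>_. (x0, u0)) (inf (nhds (x0, u0)) (principal (gph (restrict_to S (sdom S))))) sequentially"
      using u0 by (simp add: filterlim_inf filterlim_principal)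
    have "(0, 0) \<in> normal_cone (gph S) (x0, u0)"
      using u0 by (intro subsetD[OF regular_subset_normal_cone])
        (auto simp: regular_normal_cone_def polar_cone_def)
    then show "(0, - 0) \<in> (case (x0, u0) of (x', u') \<Rightarrow> proj_set (tangent_cone (sdom S) x' \<times> UNIV)
        (normal_cone (gph (restrict_to S (sdom S))) (x', u')))" for k :: nat
      using zero_in_tangent_cone[OF x0] by (auto intro!: proj_set_memI)
  qed auto
  ultimately show ?thesis by blast
qed

text \<open>By convexity \<open>x - y\<close> is tangent to the domain at \<open>y\<close>, so the normal with first component
  \<open>sgn (x - y)\<close> produced by the minimisation is its own projection and contradicts the estimate.\<close>

lemma lipschitz_like_relI:
  fixes S :: "'a::euclidean_space \<Rightarrow> 'b::euclidean_space set"
  assumes lc: "locally_closed_at (gph S) (x0, u0)"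
    and cl: "closed (gph S \<inter> cball (x0, u0) R)" and R: "R > 0" and u0: "u0 \<in> S x0"
    and conv: "closed_convex_around (sdom S) x0"
    and \<epsilon>: "\<epsilon> > 0" and c: "c > 0"
    and est: "\<And>x u t p. dist (x, u) (x0, u0) < \<epsilon> \<Longrightarrow>
       (t, p) \<in> proj_set (tangent_cone (sdom S) x \<times> UNIV) (normal_cone (gph S) (x, u)) \<Longrightarrow>
       c * norm t \<le> norm p"
  shows "lipschitz_like_rel S (sdom S) x0 u0"
proof -
  obtain U where U: "x0 \<in> interior U" "convex (sdom S \<inter> U)"
    using conv unfolding closed_convex_around_def by blast
  then obtain r where r: "r > 0" "cball x0 r \<subseteq> U" by (auto simp: mem_interior_cball)
  \<comment> \<open>For a unit first component the estimate would demand
    \<open>c \<le> norm v \<le> l\<close>; halving \<open>c\<close> rules this out.\<close>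
  define l where "l = c / 2"
  define M where "M = 3 + 1 / l"
  \<comment> \<open>A radius valid for closedness, the normal estimate and convexity alike.
    \<open>\<eta>\<close> solves \<open>2 * \<eta> + M * (2 * \<eta>) = m\<close>: the first term
    bounds the distance of \<open>(x', u')\<close> from the reference point, the second the
    excursion to \<open>(y, w)\<close>.\<close>
  define m where "m = min R (min \<epsilon> r)"
  define \<eta> where "\<eta> = m / (2 + 2 * M)"
  have l: "0 < l" "l < c" using c by (auto simp: l_def)
  then have M: "M > 0" by (simp add: M_def add_pos_pos)
  have m: "m > 0" "m \<le> R" "m \<le> \<epsilon>" "m \<le> r" using R \<epsilon> r by (auto simp: m_def)
  have "\<eta> * (2 + 2 * M) = m" using M by (simp add: \<eta>_def)
  then have \<eta>: "\<eta> > 0" "2 * \<eta> + M * (2 * \<eta>) = m"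
    using m M by (simp add: \<eta>_def, simp only: algebra_simps)
  have "M * (2 * \<eta>) > 0" using M \<eta>(1) by simp
  then have \<eta>r: "\<eta> < r" using \<eta> m by linarith
  have "\<exists>u b. u' = u + ((1 + 1 / l) * norm (x' - x)) *\<^sub>R b \<and> u \<in> S x \<and> b \<in> cball 0 1"
    if x: "x \<in> sdom S" "dist x x0 < \<eta>" and x': "dist x' x0 < \<eta>"
      and u': "u' \<in> S x'" "dist u' u0 < \<eta>" for x x' u'
  proof (cases "x = x'")
    case True
    then show ?thesis using u' by (intro exI[of _ u'] exI[of _ 0]) auto
  next
    case False
    have d': "dist (x', u') (x0, u0) < 2 * \<eta>"
      using norm_Pair_le[of "x' - x0" "u' - u0"] x' u'(2) by (simp add: dist_norm)
    have "norm (x - x') < 2 * \<eta>"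
      using x x' dist_triangle2[of x x' x0] by (simp add: dist_norm)
    then have "M * norm (x - x') < M * (2 * \<eta>)" using M by simp
    with d' have dm: "dist (x', u') (x0, u0) + M * norm (x - x') < m" using \<eta>(2) by linarith
    obtain y w where yw: "(y, w) \<in> gph S" "dist (y, w) (x', u') \<le> M * norm (x - x')"
      "norm (w - u') \<le> (1 + 1 / l) * norm (x - x')"
      "y = x \<or> (\<exists>v. norm v \<le> l \<and> (sgn (x - y), - v) \<in> regular_normal_cone (gph S) (y, w))"
    proof (rule approach_or_normal[OF cl, of x' u' l x])
      show "dist (x', u') (x0, u0) + (3 + 1 / l) * norm (x - x') < R"
        using dm m(2) unfolding M_def by linarith
    qed (use u' l False that in \<open>auto simp: M_def\<close>)
    have "y = x"
    proof (rule ccontr)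
      assume ne: "y \<noteq> x"
      then obtain v where v: "norm v \<le> l" "(sgn (x - y), - v) \<in> regular_normal_cone (gph S) (y, w)"
        using yw(4) by blast
      have dz: "dist (y, w) (x0, u0) < m"
        using yw(2) dm dist_triangle[of "(y, w)" "(x0, u0)" "(x', u')"] by linarith
      have "dist y x0 \<le> dist (y, w) (x0, u0)"
        using dist_fst_le[of "(y, w)" "(x0, u0)"] by simp
      then have "y \<in> sdom S \<inter> U" using yw(1) dz m(4) r(2) by (auto simp: sdom_def dist_commute)
      moreover have "x \<in> sdom S \<inter> U" using x \<eta>r r(2) by (auto simp: dist_commute)
      ultimately have "closed_segment y x \<subseteq> sdom S" using closed_segment_subset[OF _ _ U(2), of y x] by auto
      then have "x - y \<in> tangent_cone (sdom S) y" by (rule diff_in_tangent_cone)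
      then have "sgn (x - y) \<in> tangent_cone (sdom S) y"
        unfolding sgn_div_norm using ne by (intro tangent_cone_scaleR) auto
      then have "(sgn (x - y), - v) \<in>
          proj_set (tangent_cone (sdom S) y \<times> UNIV) (normal_cone (gph S) (y, w))"
        using subsetD[OF regular_subset_normal_cone v(2)] by (intro proj_set_memI) auto
      then have "c * norm (sgn (x - y)) \<le> norm (- v)" using dz m(3) by (intro est) auto
      then show False using v(1) l ne by (simp add: norm_sgn)
    qed
    \<comment> \<open>This already carries the factor \<open>norm (x' - x)\<close>; dividing
      \<open>u' - w\<close> by it supplies the unit-ball element.\<close>
    define \<kappa> where "\<kappa> = (1 + 1 / l) * norm (x' - x)"
    have \<kappa>: "\<kappa> > 0" using False l by (auto simp: \<kappa>_def intro!: mult_pos_pos add_pos_pos)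
    have "norm (u' - w) \<le> \<kappa>" using yw(3) by (simp add: \<kappa>_def norm_minus_commute)
    then have "norm ((1 / \<kappa>) *\<^sub>R (u' - w)) \<le> 1" unfolding norm_scaleR using \<kappa> by simp
    then have "(1 / \<kappa>) *\<^sub>R (u' - w) \<in> cball 0 1" unfolding mem_cball_0 .
    moreover have "w \<in> S x" using yw(1) \<open>y = x\<close> by simp
    moreover have "u' = w + \<kappa> *\<^sub>R ((1 / \<kappa>) *\<^sub>R (u' - w))" using \<kappa> by simp
    ultimately show ?thesis
      unfolding \<kappa>_def[symmetric] by blast
  qed
  then have "\<forall>x\<in>sdom S \<inter> ball x0 \<eta>. \<forall>x'\<in>sdom S \<inter> ball x0 \<eta>. S x' \<inter> ball u0 \<eta>
      \<subseteq> {u + ((1 + 1 / l) * norm (x' - x)) *\<^sub>R b | u b. u \<in> S x \<and> b \<in> cball 0 1}"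
    by (simp add: subset_iff dist_commute)
  moreover have "x0 \<in> interior (ball x0 \<eta>)" "u0 \<in> interior (ball u0 \<eta>)" "0 \<le> 1 + 1 / l"
    using \<eta> l by (auto simp: interior_open)
  ultimately show ?thesis
    using lc u0 unfolding lipschitz_like_rel_def
    by (intro conjI exI[of _ "ball x0 \<eta>"] exI[of _ "ball u0 \<eta>"] exI[of _ "1 + 1 / l"])
       (auto simp only: sdom_def)
qed

theorem theorem3p2:
  fixes S :: "real ^ 'n \<Rightarrow> (real ^ 'm) set"
    and x0 :: "real ^ 'n" and u0 :: "real ^ 'm"
  assumes "x0 \<in> sdom S" and "u0 \<in> S x0"
    and "locally_closed_at (gph S) (x0, u0)"
    and "closed_convex_around (sdom S) x0"
    and "\<And>x t. x \<in> tangent_cone (sdom S) x0 \<Longrightarrow> (\<forall>k::nat. 0 < t k) \<Longrightarrow> t \<longlonglongrightarrow> 0 \<Longrightarrow>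
           \<exists>u. liminf (\<lambda>k. ereal (infdist (x0 + t k *\<^sub>R x, u0 + t k *\<^sub>R u) (gph S) / t k)) = 0"
    and "\<And>x u. x \<in> tangent_cone (sdom S) x0 \<Longrightarrow> (x, u) \<in> tangent_cone (gph S) (x0, u0) \<Longrightarrow>
           (x, u) \<noteq> (0, 0) \<Longrightarrow> dir_coderivative S (x0, u0) (x, u) 0 = {0}"
  shows "proj_coderivative S (sdom S) x0 u0 0 = {0} \<and> lipschitz_like_rel S (sdom S) x0 u0"
proof -
  obtain U where U: "(x0, u0) \<in> interior U" "closed (gph S \<inter> U)"
    using assms(3) unfolding locally_closed_at_def by blast
  then obtain R where R: "R > 0" "cball (x0, u0) R \<subseteq> U" by (auto simp: mem_interior_cball)
  then have "gph S \<inter> cball (x0, u0) R = (gph S \<inter> U) \<inter> cball (x0, u0) R" by blast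
  then have cl: "closed (gph S \<inter> cball (x0, u0) R)" using U(2) by (metis closed_Int closed_cball)
  \<comment> \<open>Hypothesis (i) is read along \<open>inverse (Suc k)\<close>.\<close>
  have tan: "\<exists>u. (x, u) \<in> tangent_cone (gph S) (x0, u0)" if x: "x \<in> tangent_cone (sdom S) x0" for x
  proof -
    have t: "\<And>k. 0 < inverse (real (Suc k))" "(\<lambda>k. inverse (real (Suc k))) \<longlonglongrightarrow> 0"
      by (simp, rule LIMSEQ_inverse_real_of_nat)
    then obtain u where "liminf (\<lambda>k. ereal (infdist (x0 + inverse (real (Suc k)) *\<^sub>R x,
        u0 + inverse (real (Suc k)) *\<^sub>R u) (gph S) / inverse (real (Suc k)))) = 0"
      using assms(5)[OF x, of "\<lambda>k. inverse (real (Suc k))"] by blast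
    then have "(x, u) \<in> tangent_cone (gph S) (x0, u0)"
      using assms(2) by (intro tangent_cone_if_liminf[OF _ t]) auto
    then show ?thesis ..
  qed
  have dir: "dir_coderivative S (x0, u0) d 0 = {0}" if "d \<in> tangent_cone (gph S) (x0, u0)" "d \<noteq> 0" for d
    using that assms(6)[of "fst d" "snd d"] fst_tangent_cone_gph[of "fst d" "snd d"]
    by (auto simp: prod_eq_iff)
  obtain \<epsilon> c where "\<epsilon> > 0" "c > 0"
    and "\<And>x u t p. dist (x, u) (x0, u0) < \<epsilon> \<Longrightarrow>
       (t, p) \<in> proj_set (tangent_cone (sdom S) x \<times> UNIV) (normal_cone (gph S) (x, u)) \<Longrightarrow>
       c * norm t \<le> norm p"
    using projected_normals[OF cl R(1) assms(2) tan dir] by blast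
  then show ?thesis
    using proj_coderivative_zero[where S = S] lipschitz_like_relI[OF assms(3) cl R(1) assms(2,4)] assms(2)
    by blast
qed

end
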